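(* Let an ellipse in the Euclidean plane $\mathbb{R}^2$ with center $C$, semi-major axis $a$ and semi-minor axis $b$ be given. Then the eccentrices of this ellipse are the diagonal lines of the rectangle circumscribed about the ellipse whose sides are parallel to the axes of the ellipse, and the constant of this ellipse is $\frac{2a^2b^2}{a^2+b^2}$, which is the square of the Euclidean distance from the intersection point of an eccentrix and the ellipse to the other eccentrix. In addition, this ellipse is a $(v_1,v_2)$-Euclidean circle with center $C$ and radius $\frac{\sqrt{2}\,ab}{\sqrt{a^2+b^2}}$, with respect to the $(v_1,v_2)$-Euclidean metric, for $\lambda_1=\lambda_2=1$ and linearly independent unit vectors $v_1$ and $v_2$, each of which is perpendicular to one of the eccentrices of the ellipse.
   Context: Let $d_E(P,l)$ denote the Euclidean distance from a point $P$ to a line $l$. In the Euclidean plane, an ellipse is described as the set of all points $P$ for each of which the sum of squares of its distances to two intersecting fixed lines $l_1,l_2$ is constant, that is, $(d_E(P,l_1))^2+(d_E(P,l_2))^2=c$ with $c>0$. Each of the fixed lines $l_1,l_2$ is called an eccentrix of the ellipse (plural: eccentrices), and $c$ is called the constant of the ellipse. The center of an ellipse is its center of symmetry. A rectangle circumscribed about the ellipse has its four sides tangent to the ellipse. For linearly independent unit vectors $v_i=(v_{i1},v_{i2})$, $i=1,2$, and positive real weights $\lambda_1,\lambda_2$, the $(v_1,v_2)$-Euclidean distance (metric) between $P_1=(x_1,y_1)$ and $P_2=(x_2,y_2)$ in $\mathbb{R}^2$ is $$d_{E(v_1,v_2)}(P_1,P_2)=\left[(\lambda_1|v_{11}(x_1-x_2)+v_{12}(y_1-y_2)|)^2+(\lambda_2|v_{21}(x_1-x_2)+v_{22}(y_1-y_2)|)^2\right]^{1/2},$$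 and the $(v_1,v_2)$-Euclidean circle with center $C$ and radius $r>0$ is $\{P\in\mathbb{R}^2: d_{E(v_1,v_2)}(C,P)=r\}$. *)

theory Defs
  imports "HOL-Analysis.Analysis"
begin

type_synonym plane = "real ^ 2"

definition is_line :: "plane set \<Rightarrow> bool" where
  "is_line l \<longleftrightarrow> affine l \<and> aff_dim l = 1"

definition perpendicular_sets :: "plane set \<Rightarrow> plane set \<Rightarrow> bool" where
  "perpendicular_sets S T \<longleftrightarrow> (\<forall>p\<in>S. \<forall>q\<in>S. \<forall>r\<in>T. \<forall>s\<in>T. orthogonal (q - p) (s - r))"

definition normal_to :: "plane \<Rightarrow> plane set \<Rightarrow> bool" where
  "normal_to v l \<longleftrightarrow> (\<forall>p\<in>l. \<forall>q\<in>l. orthogonal v (q - p))"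

(* For nonempty affine S, the map P \<mapsto> 2 * closest_point S P - P is the reflection in S:
   the point reflection if S is a singleton, the axial reflection if S is a line. *)
definition symmetric_about :: "plane set \<Rightarrow> plane set \<Rightarrow> bool" where
  "symmetric_about E S \<longleftrightarrow> (\<lambda>P. 2 *\<^sub>R closest_point S P - P) ` E = E"

definition eccentrices :: "plane set \<Rightarrow> plane set \<Rightarrow> plane set \<Rightarrow> real \<Rightarrow> bool" where
  "eccentrices E l1 l2 c \<longleftrightarrow>
     is_line l1 \<and> is_line l2 \<and> l1 \<noteq> l2 \<and> l1 \<inter> l2 \<noteq> {} \<and> c > 0 \<and>
     E = {P. (infdist P l1)\<^sup>2 + (infdist P l2)\<^sup>2 = c}"

definition is_ellipse :: "plane set \<Rightarrow> bool" where
  "is_ellipse E \<longleftrightarrow> (\<exists>l1 l2 c. eccentrices E l1 l2 c)"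

definition is_center :: "plane set \<Rightarrow> plane \<Rightarrow> bool" where
  "is_center E C \<longleftrightarrow> symmetric_about E {C}"

(* m1 and m2 are the major and the minor axis (as full lines) of the ellipse E with center C:
   perpendicular lines of symmetry through C that meet E at distance a and b from C, a \<ge> b.
   A circle is the case a = b; every pair of perpendicular lines through its center
   is then a pair of axes. *)
definition ellipse_axes ::
    "plane set \<Rightarrow> plane \<Rightarrow> real \<Rightarrow> real \<Rightarrow> plane set \<Rightarrow> plane set \<Rightarrow> bool" where
  "ellipse_axes E C a b m1 m2 \<longleftrightarrow>
     is_line m1 \<and> is_line m2 \<and> perpendicular_sets m1 m2 \<and> C \<in> m1 \<and> C \<in> m2 \<and>
     symmetric_about E m1 \<and> symmetric_about E m2 \<and>
     (\<exists>P\<in>E \<inter> m1. dist C P = a) \<and> (\<exists>P\<in>E \<inter> m2. dist C P = b) \<and> b \<le> a"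

definition rectangle :: "plane \<Rightarrow> plane \<Rightarrow> plane \<Rightarrow> plane \<Rightarrow> bool" where
  "rectangle p q r s \<longleftrightarrow> p \<noteq> q \<and> p \<noteq> s \<and> q - p = r - s \<and> orthogonal (q - p) (s - p)"

(* A line is tangent to an ellipse iff it meets it in exactly one point;
   for a side, the point of contact also has to lie on the segment. *)
definition tangent_side :: "plane set \<Rightarrow> plane \<Rightarrow> plane \<Rightarrow> bool" where
  "tangent_side E p q \<longleftrightarrow> (\<exists>T\<in>closed_segment p q. affine hull {p, q} \<inter> E = {T})"

definition circumscribed_rectangle :: "plane set \<Rightarrow> plane \<Rightarrow> plane \<Rightarrow> plane \<Rightarrow> plane \<Rightarrow> bool" where
  "circumscribed_rectangle E p q r s \<longleftrightarrow>
     rectangle p q r s \<and>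
     tangent_side E p q \<and> tangent_side E q r \<and> tangent_side E r s \<and> tangent_side E s p"

(* The rectangle is unique as a set; relabelling its vertices exchanges d1 and d2. *)
definition circumscribed_diagonals ::
    "plane set \<Rightarrow> plane set \<Rightarrow> plane set \<Rightarrow> plane set \<Rightarrow> plane set \<Rightarrow> bool" where
  "circumscribed_diagonals E m1 m2 d1 d2 \<longleftrightarrow>
     (\<exists>p q r s. circumscribed_rectangle E p q r s \<and>
        affine_parallel (affine hull {p, q}) m1 \<and> affine_parallel (affine hull {q, r}) m2 \<and>
        affine_parallel (affine hull {r, s}) m1 \<and> affine_parallel (affine hull {s, p}) m2 \<and>
        d1 = affine hull {p, r} \<and> d2 = affine hull {q, s})"

definition dist_vE :: "real \<Rightarrow> real \<Rightarrow> plane \<Rightarrow> plane \<Rightarrow> plane \<Rightarrow> plane \<Rightarrow> real" where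
  "dist_vE w1 w2 v1 v2 P1 P2 =
     sqrt ((w1 * \<bar>v1 $ 1 * (P1 $ 1 - P2 $ 1) + v1 $ 2 * (P1 $ 2 - P2 $ 2)\<bar>)\<^sup>2
         + (w2 * \<bar>v2 $ 1 * (P1 $ 1 - P2 $ 1) + v2 $ 2 * (P1 $ 2 - P2 $ 2)\<bar>)\<^sup>2)"

(* The distinctness of v1 and v2 is needed because independence is a property
   of the set {v1, v2}. *)
definition is_vE_circle ::
    "real \<Rightarrow> real \<Rightarrow> plane \<Rightarrow> plane \<Rightarrow> plane \<Rightarrow> real \<Rightarrow> plane set \<Rightarrow> bool" where
  "is_vE_circle w1 w2 v1 v2 C r E \<longleftrightarrow>
     norm v1 = 1 \<and> norm v2 = 1 \<and> v1 \<noteq> v2 \<and> independent {v1, v2} \<and> w1 > 0 \<and> w2 > 0 \<and> r > 0 \<and>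
     E = {P. dist_vE w1 w2 v1 v2 C P = r}"

end

theory Submission
  imports Defs
begin

text \<open>With unit normals \<open>n1\<close>, \<open>n2\<close> of the eccentrices the ellipse is a level set of the quadratic form
  \<open>(n1 \<bullet> x)\<^sup>2 + (n2 \<bullet> x)\<^sup>2\<close> centered at \<open>C\<close>. Symmetry about the axes diagonalizes this form in the
  orthonormal frame \<open>u\<close>, \<open>w\<close> of the axes; its diagonal entries are \<open>c / a\<^sup>2\<close> and \<open>c / b\<^sup>2\<close>, and its
  trace is \<open>2\<close> because \<open>n1\<close> and \<open>n2\<close> are unit vectors, which gives the constant \<open>c\<close>. The circumscribed
  rectangle has the vertices \<open>C \<plusminus> a u \<plusminus> b w\<close>; unless \<open>a = b\<close>, the diagonalization forces
  \<open>n1\<close> and \<open>n2\<close> to be perpendicular to its diagonals.\<close>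

section \<open>Orthonormal frames of the plane\<close>

text \<open>The matrix with rows \<open>u\<close> and \<open>w\<close> has orthonormal rows, hence
  orthonormal columns; the coordinatewise computation uses the column relations.\<close>

lemma orthonormal_plane_expand:
  fixes u w x :: plane
  assumes "norm u = 1" "norm w = 1" "u \<bullet> w = 0"
  shows "x = (u \<bullet> x) *\<^sub>R u + (w \<bullet> x) *\<^sub>R w"
proof -
  have u: "u $ 1 * u $ 1 + u $ 2 * u $ 2 = 1" and w: "w $ 1 * w $ 1 + w $ 2 * w $ 2 = 1"
    using assms(1,2) by (auto simp: norm_eq_1 inner_vec_def sum_2)
  have uw: "u $ 1 * w $ 1 + u $ 2 * w $ 2 = 0"
    using assms(3) by (auto simp: inner_vec_def sum_2)
  have 1: "u $ 1 * u $ 1 + w $ 1 * w $ 1 = 1" using u w uw by algebra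
  have 2: "u $ 2 * u $ 2 + w $ 2 * w $ 2 = 1" using u w uw by algebra
  have 3: "u $ 1 * u $ 2 + w $ 1 * w $ 2 = 0" using u w uw by algebra
  have "x $ 1 = (u $ 1 * x $ 1 + u $ 2 * x $ 2) * u $ 1 + (w $ 1 * x $ 1 + w $ 2 * x $ 2) * w $ 1"
    using 1 3 by algebra
  moreover have "x $ 2 = (u $ 1 * x $ 1 + u $ 2 * x $ 2) * u $ 2 + (w $ 1 * x $ 1 + w $ 2 * x $ 2) * w $ 2"
    using 2 3 by algebra
  ultimately show ?thesis
    by (simp add: vec_eq_iff forall_2 inner_vec_def sum_2)
qed

lemma plane_unit_perp:
  fixes u :: plane
  assumes "norm u = 1"
  obtains w :: plane where "norm w = 1" "u \<bullet> w = 0"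
proof
  show "norm (vector [- u $ 2, u $ 1] :: plane) = 1"
    using assms by (simp add: norm_eq_1 inner_vec_def sum_2)
  show "u \<bullet> vector [- u $ 2, u $ 1] = 0"
    by (simp add: inner_vec_def sum_2)
qed

section \<open>Lines given by a direction or by a normal\<close>

text \<open>The direction form suits affine hulls, parallels and reflections; the normal form
  \<open>nline\<close> suits distances and quadratic forms.\<close>

definition dline :: "plane \<Rightarrow> plane \<Rightarrow> plane set" where
  "dline C d = range (\<lambda>t. C + t *\<^sub>R d)"

definition nline :: "plane \<Rightarrow> plane \<Rightarrow> plane set" where
  "nline C n = {P. n \<bullet> (P - C) = 0}"

lemma range_eqI_reparam:
  assumes "\<And>t. f t = g (h t)" "\<And>t. g t = f (h' t)"
  shows "range f = range g"
  using assms by (metis image_subset_iff rangeI subset_antisym)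

lemma affine_hull_pair_dline: "affine hull {p, q} = dline p (q - p)"
  unfolding dline_def affine_hull_2_alt by simp

lemma base_in_dline [simp]: "C \<in> dline C d"
  unfolding dline_def by (rule image_eqI[of _ _ 0]) auto

lemma dline_scale:
  assumes "k \<noteq> 0"
  shows "dline C (k *\<^sub>R d) = dline C d"
  unfolding dline_def using assms
  by (intro range_eqI_reparam[of _ _ "\<lambda>t. t * k" "\<lambda>t. t / k"]) auto

lemma dline_move:
  assumes "p \<in> dline C d"
  shows "dline p d = dline C d"
proof -
  obtain k where k: "p = C + k *\<^sub>R d" using assms by (auto simp: dline_def)
  show ?thesis unfolding dline_def
    by (intro range_eqI_reparam[of _ _ "\<lambda>t. k + t" "\<lambda>t. t - k"]) (auto simp: k algebra_simps)
qed

lemma is_line_dline: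
  assumes "d \<noteq> 0"
  shows "is_line (dline C d)"
proof -
  have "dline C d = affine hull {C, C + d}" by (simp add: affine_hull_pair_dline)
  then show ?thesis using assms by (simp add: is_line_def aff_dim_2)
qed

text \<open>The hull of \<open>C\<close> and a second point of \<open>l\<close> is an affine subset
  of the same dimension, hence all of \<open>l\<close>.\<close>

lemma is_line_obtain_dline:
  assumes "is_line l" "C \<in> l"
  obtains u where "norm u = 1" "l = dline C u"
proof -
  have "l \<noteq> {C}" using assms(1) by (auto simp: is_line_def)
  then obtain q where q: "q \<in> l" "q \<noteq> C" using assms(2) by blast
  have "affine hull {C, q} \<subseteq> l"
    using assms q by (simp add: hull_minimal is_line_def)
  moreover have "aff_dim (affine hull {C, q}) = aff_dim l"
    using assms q by (simp add: is_line_def aff_dim_2)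
  ultimately have "affine hull {C, q} = l"
    using assms by (intro affine_dim_equal) (auto simp: is_line_def)
  then have "l = dline C (q - C)" by (simp add: affine_hull_pair_dline)
  also have "\<dots> = dline C ((1 / norm (q - C)) *\<^sub>R (q - C))"
    using q by (intro dline_scale[symmetric]) auto
  finally show ?thesis using q by (intro that) auto
qed

text \<open>The normalized vectors \<open>d\<close> and \<open>n\<close> form an orthonormal frame,
  in which a vector orthogonal to \<open>n\<close> keeps only its component along
  \<open>d\<close>.\<close>

lemma dline_eq_nline:
  assumes "d \<noteq> 0" "n \<noteq> 0" "n \<bullet> d = 0"
  shows "dline C d = nline C n"
proof -
  define u w where "u = (1 / norm d) *\<^sub>R d" and "w = (1 / norm n) *\<^sub>R n"
  have uw: "norm u = 1" "norm w = 1" "u \<bullet> w = 0"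
    using assms by (auto simp: u_def w_def inner_commute)
  have "P \<in> dline C d" if "n \<bullet> (P - C) = 0" for P
  proof -
    have "w \<bullet> (P - C) = 0" using that by (simp add: w_def)
    then obtain k where "P - C = k *\<^sub>R u"
      using orthonormal_plane_expand[OF uw, of "P - C"] by auto
    then have "P = C + (k / norm d) *\<^sub>R d" by (simp add: u_def diff_eq_eq add.commute)
    then show ?thesis unfolding dline_def by blast
  qed
  then show ?thesis using assms by (auto simp: nline_def dline_def)
qed

lemma is_line_nline:
  assumes "norm n = 1"
  shows "is_line (nline C n)"
proof -
  obtain d where "norm d = 1" "n \<bullet> d = 0" using plane_unit_perp[OF assms] .
  then have "nline C n = dline C d"
    using assms by (intro dline_eq_nline[symmetric]) auto
  moreover have "d \<noteq> 0" using \<open>norm d = 1\<close> by auto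
  ultimately show ?thesis by (simp add: is_line_dline)
qed

lemma is_line_obtain_normal:
  assumes "is_line l"
  obtains v where "norm v = 1" "normal_to v l"
proof -
  have "l \<noteq> {}" using assms by (auto simp: is_line_def)
  then obtain C where "C \<in> l" by blast
  then obtain d where d: "norm d = 1" "l = dline C d" using is_line_obtain_dline assms by metis
  obtain v where "norm v = 1" "d \<bullet> v = 0" using plane_unit_perp[OF d(1)] .
  then have "normal_to v l"
    by (auto simp: normal_to_def d dline_def orthogonal_def inner_simps inner_commute)
  then show ?thesis using that \<open>norm v = 1\<close> by blast
qed

lemma is_line_eq_nline:
  assumes "is_line l" "C \<in> l" "norm v = 1" "normal_to v l"
  shows "l = nline C v"
proof -
  obtain d where d: "norm d = 1" "l = dline C d" using is_line_obtain_dline assms by metis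
  have "C + 1 *\<^sub>R d \<in> l" unfolding d dline_def by blast
  then have "v \<bullet> d = 0" using assms(2,4) by (force simp: normal_to_def orthogonal_def)
  then show ?thesis unfolding d(2) using d(1) assms(3) by (intro dline_eq_nline) auto
qed

section \<open>Distances, projections and parallels\<close>

text \<open>The foot of the perpendicular gives the upper bound, the Cauchy-Schwarz inequality the
  lower one.\<close>

lemma infdist_nline:
  assumes "norm n = 1"
  shows "infdist P (nline C n) = \<bar>n \<bullet> (P - C)\<bar>"
proof (rule antisym)
  have nn: "n \<bullet> n = 1" using assms by (simp add: norm_eq_1)
  have "P - (n \<bullet> (P - C)) *\<^sub>R n \<in> nline C n"
    by (simp add: nline_def inner_simps nn)
  from infdist_le[OF this, of P] show "infdist P (nline C n) \<le> \<bar>n \<bullet> (P - C)\<bar>"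
    using assms by (simp add: dist_norm)
  have "\<bar>n \<bullet> (P - C)\<bar> \<le> dist P x" if "x \<in> nline C n" for x
  proof -
    have "n \<bullet> (P - C) = n \<bullet> (P - x)" using that by (simp add: nline_def inner_simps)
    then show ?thesis using Cauchy_Schwarz_ineq2[of n "P - x"] assms by (simp add: dist_norm)
  qed
  moreover have "nline C n \<noteq> {}" by (auto simp: nline_def intro!: exI[of _ C])
  ultimately show "\<bar>n \<bullet> (P - C)\<bar> \<le> infdist P (nline C n)"
    by (simp add: infdist_notempty cINF_greatest)
qed

lemma closest_point_dline:
  assumes "norm u = 1"
  shows "closest_point (dline C u) P = C + (u \<bullet> (P - C)) *\<^sub>R u"
proof -
  have uu: "u \<bullet> u = 1" using assms by (simp add: norm_eq_1)
  have "u \<noteq> 0" using assms by auto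
  then have "affine (dline C u)" using is_line_dline by (auto simp: is_line_def)
  then have cl: "closed (dline C u)" "convex (dline C u)"
    by (simp_all add: affine_closed affine_imp_convex)
  have le: "dist P (C + (u \<bullet> (P - C)) *\<^sub>R u) \<le> dist P z" if zin: "z \<in> dline C u" for z
  proof -
    obtain t where z: "z = C + t *\<^sub>R u" using zin by (auto simp: dline_def)
    define D where "D = P - C"
    \<comment> \<open>Pythagoras: the squared distance to a point of the line exceeds that to the
      foot by a square.\<close>
    have "(norm (D - t *\<^sub>R u))\<^sup>2 = (norm (D - (u \<bullet> D) *\<^sub>R u))\<^sup>2 + (t - u \<bullet> D)\<^sup>2"
      unfolding power2_norm_eq_inner
      by (simp add: inner_simps uu inner_commute power2_eq_square algebra_simps)
    then have "(norm (D - (u \<bullet> D) *\<^sub>R u))\<^sup>2 \<le> (norm (D - t *\<^sub>R u))\<^sup>2" by simp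
    then have "norm (D - (u \<bullet> D) *\<^sub>R u) \<le> norm (D - t *\<^sub>R u)"
      by (rule power2_le_imp_le) simp
    then show ?thesis by (simp add: z D_def dist_norm diff_diff_eq)
  qed
  have "C + (u \<bullet> (P - C)) *\<^sub>R u \<in> dline C u" unfolding dline_def by blast
  then show ?thesis using closest_point_unique[OF cl(2,1), of _ P] le by metis
qed

lemma affine_parallel_dline:
  assumes "affine_parallel S (dline C d)" "p \<in> S"
  shows "S = dline p d"
proof -
  obtain v where v: "S = (+) v ` dline C d"
    using assms(1) affine_parallel_commute unfolding affine_parallel_def by blast
  then have S: "S = dline (v + C) d" by (auto simp: dline_def image_image algebra_simps)
  then show ?thesis using dline_move assms(2) by metis
qed

lemma affine_parallel_dline_dline: "affine_parallel (dline p d) (dline C d)"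
  unfolding affine_parallel_def
  by (rule exI[of _ "C - p"]) (auto simp: dline_def image_image algebra_simps)

section \<open>The ellipse as a level set of a quadratic form\<close>

lemma eccentrices_nline_iff:
  assumes "norm n1 = 1" "norm n2 = 1"
  shows "eccentrices E (nline C n1) (nline C n2) c \<longleftrightarrow>
    nline C n1 \<noteq> nline C n2 \<and> c > 0 \<and> E = {P. (n1 \<bullet> (P - C))\<^sup>2 + (n2 \<bullet> (P - C))\<^sup>2 = c}"
proof -
  have "C \<in> nline C n1 \<inter> nline C n2" by (simp add: nline_def)
  then show ?thesis
    using assms by (auto simp: eccentrices_def is_line_nline infdist_nline)
qed

text \<open>A zero \<open>d\<close> of the form would be a common direction of both lines. Positive
  definiteness ensures that every line through \<open>C\<close> meets the ellipse.\<close>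

lemma nline_distinct_form_pos:
  assumes "norm n1 = 1" "norm n2 = 1" "nline C n1 \<noteq> nline C n2" "d \<noteq> 0"
  shows "(n1 \<bullet> d)\<^sup>2 + (n2 \<bullet> d)\<^sup>2 > 0"
proof (rule ccontr)
  assume "\<not> ?thesis"
  then have "n1 \<bullet> d = 0" "n2 \<bullet> d = 0"
    by (auto simp: sum_power2_gt_zero_iff)
  then have "nline C n1 = dline C d" "nline C n2 = dline C d"
    using assms by (intro dline_eq_nline[symmetric]; auto)+
  with assms(3) show False by simp
qed

text \<open>Produces the point of the ellipse on a given ray from the center. The factored version
  serves to compare it with other points, the last one to prove membership.\<close>

lemma form_scale_to:
  fixes n1 n2 d :: plane
  assumes "(n1 \<bullet> d)\<^sup>2 + (n2 \<bullet> d)\<^sup>2 > 0" "c > 0"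
  obtains k where "k > 0" "k\<^sup>2 * ((n1 \<bullet> d)\<^sup>2 + (n2 \<bullet> d)\<^sup>2) = c"
    "(n1 \<bullet> (k *\<^sub>R d))\<^sup>2 + (n2 \<bullet> (k *\<^sub>R d))\<^sup>2 = c"
proof -
  define k where "k = sqrt (c / ((n1 \<bullet> d)\<^sup>2 + (n2 \<bullet> d)\<^sup>2))"
  have k: "k > 0" "k\<^sup>2 * ((n1 \<bullet> d)\<^sup>2 + (n2 \<bullet> d)\<^sup>2) = c"
    using assms by (auto simp: k_def)
  then show ?thesis by (intro that) (auto simp: power_mult_distrib algebra_simps)
qed

lemma is_center_iff: "is_center E C \<longleftrightarrow> (\<lambda>P. 2 *\<^sub>R C - P) ` E = E"
proof -
  have "closest_point {C} P = C" for P
    using closest_point_in_set[of "{C}" P] by simp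
  then show ?thesis by (simp add: is_center_def symmetric_about_def)
qed

text \<open>If \<open>C\<close> and the intersection \<open>O'\<close> of the eccentrices differed, the composition of both point
  reflections would be a translation preserving the bounded set \<open>E\<close>.\<close>

lemma eccentrices_meet_at_center:
  assumes "eccentrices E l1 l2 c" "is_center E C"
  shows "C \<in> l1" "C \<in> l2"
proof -
  from assms(1) obtain O' where O': "O' \<in> l1" "O' \<in> l2" by (auto simp: eccentrices_def)
  have l: "is_line l1" "is_line l2" "l1 \<noteq> l2" using assms(1) by (auto simp: eccentrices_def)
  obtain n1 where n1: "norm n1 = 1" "normal_to n1 l1" using is_line_obtain_normal l(1) .
  obtain n2 where n2: "norm n2 = 1" "normal_to n2 l2" using is_line_obtain_normal l(2) .
  have nl: "l1 = nline O' n1" "l2 = nline O' n2"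
    using is_line_eq_nline l O' n1 n2 by blast+
  have c: "c > 0" and E: "E = {P. (n1 \<bullet> (P - O'))\<^sup>2 + (n2 \<bullet> (P - O'))\<^sup>2 = c}"
    using assms(1) n1 n2 by (auto simp: nl eccentrices_nline_iff)
  have "C = O'"
  proof (rule ccontr)
    assume "C \<noteq> O'"
    then have d: "C - O' \<noteq> 0" by simp
    have pos: "(n1 \<bullet> (C - O'))\<^sup>2 + (n2 \<bullet> (C - O'))\<^sup>2 > 0" (is "?q > 0")
      using nline_distinct_form_pos[of n1 n2 O'] l(3) n1 n2 nl d by blast
    \<comment> \<open>On the line through \<open>O'\<close> and \<open>C\<close>, measured from
      \<open>O'\<close> in multiples of \<open>C - O'\<close>, the point at \<open>- k\<close> lies
      on \<open>E\<close>. Its reflection in \<open>C\<close> lies at \<open>k + 2\<close>, so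
      \<open>(k + 2)\<^sup>2 = k\<^sup>2\<close>, impossible for positive \<open>k\<close>.\<close>
    obtain k where k: "k > 0" "k\<^sup>2 * ?q = c"
      using form_scale_to[OF pos c] by metis
    have "n \<bullet> (O' - k *\<^sub>R (C - O') - O') = - (k * (n \<bullet> (C - O')))" for n
      by (simp add: inner_simps)
    then have "O' - k *\<^sub>R (C - O') \<in> E"
      unfolding E mem_Collect_eq using k(2) by (simp only: power2_minus power_mult_distrib distrib_left)
    then have "2 *\<^sub>R C - (O' - k *\<^sub>R (C - O')) \<in> E"
      using assms(2) unfolding is_center_iff by blast
    moreover have "2 *\<^sub>R C - (O' - k *\<^sub>R (C - O')) - O' = (k + 2) *\<^sub>R (C - O')"
      by (simp add: vec_eq_iff algebra_simps)
    ultimately have "(n1 \<bullet> ((k + 2) *\<^sub>R (C - O')))\<^sup>2 + (n2 \<bullet> ((k + 2) *\<^sub>R (C - O')))\<^sup>2 = c"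
      unfolding E mem_Collect_eq by metis
    then have "(k + 2)\<^sup>2 * ?q = k\<^sup>2 * ?q"
      using k(2) by (simp only: inner_scaleR_right power_mult_distrib distrib_left)
    then have "(k + 2)\<^sup>2 = k\<^sup>2" using pos by (metis mult_right_cancel less_irrefl)
    then show False using k(1) by (simp add: power2_eq_square algebra_simps)
  qed
  then show "C \<in> l1" "C \<in> l2" using O' by auto
qed

text \<open>The unit normals are arbitrary here, so that the final circle statement covers every
  admissible pair.\<close>

lemma eccentrices_at_center:
  assumes "eccentrices E l1 l2 c" "is_center E C"
    "norm n1 = 1" "normal_to n1 l1" "norm n2 = 1" "normal_to n2 l2"
  shows "l1 = nline C n1" "l2 = nline C n2" "nline C n1 \<noteq> nline C n2" "c > 0"
    "E = {P. (n1 \<bullet> (P - C))\<^sup>2 + (n2 \<bullet> (P - C))\<^sup>2 = c}"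
proof -
  have l: "is_line l1" "is_line l2" using assms(1) by (auto simp: eccentrices_def)
  show nl: "l1 = nline C n1" "l2 = nline C n2"
    using is_line_eq_nline l eccentrices_meet_at_center[OF assms(1,2)] assms(3-6) by blast+
  show "nline C n1 \<noteq> nline C n2" "c > 0" "E = {P. (n1 \<bullet> (P - C))\<^sup>2 + (n2 \<bullet> (P - C))\<^sup>2 = c}"
    using assms(1,3,5) by (auto simp: nl eccentrices_nline_iff)
qed

lemma perpendicular_dline_inner:
  assumes "perpendicular_sets (dline C u) (dline C w)"
  shows "u \<bullet> w = 0"
proof -
  have "C + 1 *\<^sub>R u \<in> dline C u" "C + 1 *\<^sub>R w \<in> dline C w"
    unfolding dline_def by blast+
  then have "orthogonal ((C + 1 *\<^sub>R u) - C) ((C + 1 *\<^sub>R w) - C)"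
    using assms base_in_dline unfolding perpendicular_sets_def by blast
  then show ?thesis by (simp add: orthogonal_def)
qed

text \<open>Reflecting the point of \<open>E\<close> in direction \<open>u + w\<close> about the axis shows that the mixed
  coefficient of the quadratic form vanishes.\<close>

lemma axes_diagonalize:
  assumes n: "norm n1 = 1" "norm n2 = 1" "nline C n1 \<noteq> nline C n2" and c: "c > 0"
    and E: "E = {P. (n1 \<bullet> (P - C))\<^sup>2 + (n2 \<bullet> (P - C))\<^sup>2 = c}"
    and uw: "norm u = 1" "norm w = 1" "u \<bullet> w = 0"
    and sym: "symmetric_about E (dline C u)"
  shows "(n1 \<bullet> u) * (n1 \<bullet> w) + (n2 \<bullet> u) * (n2 \<bullet> w) = 0"
proof -
  have uu: "u \<bullet> u = 1" using uw by (simp add: norm_eq_1)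
  have "u \<bullet> (u + w) = 1" using uu uw by (simp add: inner_simps)
  then have nz: "u + w \<noteq> 0" by auto
  obtain k where k: "k > 0" "k\<^sup>2 * ((n1 \<bullet> (u + w))\<^sup>2 + (n2 \<bullet> (u + w))\<^sup>2) = c"
    "(n1 \<bullet> (k *\<^sub>R (u + w)))\<^sup>2 + (n2 \<bullet> (k *\<^sub>R (u + w)))\<^sup>2 = c"
    using form_scale_to[OF nline_distinct_form_pos[OF n nz] c] .
  have "C + k *\<^sub>R (u + w) \<in> E" using k(3) by (simp add: E)
  then have "2 *\<^sub>R closest_point (dline C u) (C + k *\<^sub>R (u + w)) - (C + k *\<^sub>R (u + w)) \<in> E"
    using sym unfolding symmetric_about_def by blast
  also have "2 *\<^sub>R closest_point (dline C u) (C + k *\<^sub>R (u + w)) - (C + k *\<^sub>R (u + w))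
      = C + k *\<^sub>R (u - w)"
    using uu uw by (simp add: closest_point_dline inner_simps vec_eq_iff algebra_simps)
  finally have "k\<^sup>2 * ((n1 \<bullet> (u - w))\<^sup>2 + (n2 \<bullet> (u - w))\<^sup>2) = c"
    by (simp add: E power_mult_distrib distrib_left)
  then have "k\<^sup>2 * ((n1 \<bullet> (u - w))\<^sup>2 + (n2 \<bullet> (u - w))\<^sup>2)
      = k\<^sup>2 * ((n1 \<bullet> (u + w))\<^sup>2 + (n2 \<bullet> (u + w))\<^sup>2)"
    using k(2) by simp
  then have "(n1 \<bullet> (u - w))\<^sup>2 + (n2 \<bullet> (u - w))\<^sup>2 = (n1 \<bullet> (u + w))\<^sup>2 + (n2 \<bullet> (u + w))\<^sup>2"
    using k(1) by simp
  \<comment> \<open>The two sides differ by four times the mixed coefficient.\<close>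
  then show ?thesis by (simp add: inner_simps power2_eq_square algebra_simps)
qed

section \<open>The ellipse and its circumscribed rectangle in the frame of the axes\<close>

text \<open>The standard equation is cleared of denominators. No order of \<open>a\<close> and
  \<open>b\<close> is imposed, so that the two axes can be interchanged.\<close>

locale ellipse_frame =
  fixes E :: "plane set" and C u w :: plane and a b :: real
  assumes nu: "norm u = 1" and nw: "norm w = 1" and uw: "u \<bullet> w = 0"
    and a: "a > 0" and b: "b > 0"
    and E_eq: "E = {P. b\<^sup>2 * (u \<bullet> (P - C))\<^sup>2 + a\<^sup>2 * (w \<bullet> (P - C))\<^sup>2 = a\<^sup>2 * b\<^sup>2}"
begin

definition pt :: "real \<Rightarrow> real \<Rightarrow> plane" where
  "pt s t = C + s *\<^sub>R u + t *\<^sub>R w"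

lemma inner_frame [simp]: "u \<bullet> u = 1" "w \<bullet> w = 1" "u \<bullet> w = 0" "w \<bullet> u = 0"
  using nu nw uw by (auto simp: norm_eq_1 inner_commute)

lemma pt_eq_iff [simp]: "pt s t = pt s' t' \<longleftrightarrow> s = s' \<and> t = t'"
proof
  assume "pt s t = pt s' t'"
  then have "u \<bullet> (pt s t - C) = u \<bullet> (pt s' t' - C)" "w \<bullet> (pt s t - C) = w \<bullet> (pt s' t' - C)" by simp_all
  then show "s = s' \<and> t = t'" by (simp add: pt_def inner_simps)
qed simp

lemma pt_surj: obtains s t where "P = pt s t"
proof
  show "P = pt (u \<bullet> (P - C)) (w \<bullet> (P - C))"
    using orthonormal_plane_expand[OF nu nw uw, of "P - C"] by (simp add: pt_def algebra_simps)
qed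

lemma pt_in_E: "pt s t \<in> E \<longleftrightarrow> b\<^sup>2 * s\<^sup>2 + a\<^sup>2 * t\<^sup>2 = a\<^sup>2 * b\<^sup>2"
  by (simp add: E_eq pt_def inner_simps)

lemma dline_pt_u: "dline (pt s t) u = range (\<lambda>x. pt x t)"
  unfolding dline_def
  by (intro range_eqI_reparam[of _ _ "\<lambda>x. s + x" "\<lambda>x. x - s"]) (auto simp: pt_def algebra_simps)

text \<open>The two points are symmetric about \<open>C\<close>, so the line joining them passes
  through \<open>C\<close>.\<close>

lemma dline_diag: "dline (pt s t) (pt (- s) (- t) - pt s t) = dline C (s *\<^sub>R u + t *\<^sub>R w)"
proof -
  have "pt (- s) (- t) - pt s t = (- 2) *\<^sub>R (s *\<^sub>R u + t *\<^sub>R w)"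
    by (simp add: pt_def vec_eq_iff algebra_simps)
  then have "dline (pt s t) (pt (- s) (- t) - pt s t) = dline (pt s t) (s *\<^sub>R u + t *\<^sub>R w)"
    by (simp add: dline_scale del: scaleR_minus_left)
  also have "pt s t = C + 1 *\<^sub>R (s *\<^sub>R u + t *\<^sub>R w)" by (simp add: pt_def)
  then have "pt s t \<in> dline C (s *\<^sub>R u + t *\<^sub>R w)" unfolding dline_def by blast
  then have "dline (pt s t) (s *\<^sub>R u + t *\<^sub>R w) = dline C (s *\<^sub>R u + t *\<^sub>R w)"
    by (rule dline_move)
  finally show ?thesis .
qed

text \<open>The equation of \<open>E\<close> is even in the first coordinate, so the mirror image of
  the contact point lies on the same line and on \<open>E\<close>. Uniqueness puts the contact point
  at first coordinate \<open>0\<close>.\<close>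

lemma tangent_side_u_imp:
  assumes "tangent_side E (pt s t) q" "affine hull {pt s t, q} = dline (pt s t) u"
  shows "t\<^sup>2 = b\<^sup>2"
proof -
  obtain T where T: "range (\<lambda>x. pt x t) \<inter> E = {T}"
    using assms by (auto simp: tangent_side_def dline_pt_u)
  have "T \<in> range (\<lambda>x. pt x t) \<inter> E" unfolding T by simp
  then obtain x where x: "T = pt x t" "pt x t \<in> E" by auto
  then have "pt (- x) t \<in> E" by (simp add: pt_in_E)
  then have "pt (- x) t \<in> range (\<lambda>x. pt x t) \<inter> E" by simp
  then have "pt (- x) t = pt x t" unfolding T x(1) by simp
  then have "x = 0" by simp
  then show ?thesis using x a by (simp add: pt_in_E)
qed

lemma tangent_side_u:
  assumes "t\<^sup>2 = b\<^sup>2" "s \<noteq> 0"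
  shows "tangent_side E (pt s t) (pt (- s) t)"
    "affine hull {pt s t, pt (- s) t} = dline (pt s t) u"
proof -
  have "pt (- s) t - pt s t = (- 2 * s) *\<^sub>R u" by (simp add: pt_def vec_eq_iff algebra_simps)
  then have "dline (pt s t) (pt (- s) t - pt s t) = dline (pt s t) u"
    using dline_scale[of "- 2 * s"] assms(2) by simp
  then show hull: "affine hull {pt s t, pt (- s) t} = dline (pt s t) u"
    by (simp add: affine_hull_pair_dline)
  \<comment> \<open>The contact point is the midpoint of the side.\<close>
  have "pt 0 t = (1 - 1/2) *\<^sub>R pt s t + (1/2) *\<^sub>R pt (- s) t"
    by (simp add: pt_def vec_eq_iff field_simps)
  then have "pt 0 t \<in> closed_segment (pt s t) (pt (- s) t)"
    unfolding closed_segment_def by (intro CollectI exI[of _ "1/2"]) auto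
  moreover have "range (\<lambda>x. pt x t) \<inter> E = {pt 0 t}"
    using assms b by (auto simp: pt_in_E)
  ultimately show "tangent_side E (pt s t) (pt (- s) t)"
    unfolding tangent_side_def hull dline_pt_u by blast
qed

text \<open>In coordinates the reflection negates \<open>t\<close>; this is an involution that
  preserves the equation of \<open>E\<close>.\<close>

lemma symmetric_about_u: "symmetric_about E (dline C u)"
proof -
  define f where "f = (\<lambda>P. 2 *\<^sub>R closest_point (dline C u) P - P)"
  have refl: "f (pt s t) = pt s (- t)" for s t
    by (simp add: f_def closest_point_dline nu pt_def inner_simps vec_eq_iff algebra_simps)
  have f: "f P \<in> E" "f (f P) = P" if "P \<in> E" for P
    using that by (rule_tac pt_surj[of P], simp add: refl pt_in_E)+
  have "f ` E = E"
    using f by (metis image_subset_iff image_eqI subsetI subset_antisym)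
  then show ?thesis by (simp add: symmetric_about_def f_def)
qed

end

text \<open>Interchanging the axes turns each fact on sides parallel to \<open>u\<close> into one on
  sides parallel to \<open>w\<close>; the rewrite keeps the coordinates in their original
  order.\<close>

sublocale ellipse_frame \<subseteq> swap: ellipse_frame E C w u b a
  rewrites "ellipse_frame.pt C w u = (\<lambda>s t. pt t s)"
proof -
  show "ellipse_frame E C w u b a"
    by unfold_locales (use nu nw uw a b E_eq in \<open>auto simp: inner_commute mult.commute add.commute\<close>)
  then interpret swap: ellipse_frame E C w u b a .
  show "swap.pt = (\<lambda>s t. pt t s)" by (auto simp: fun_eq_iff swap.pt_def pt_def)
qed

context ellipse_frame
begin

lemma tangent_side_w_rev:
  assumes "s\<^sup>2 = a\<^sup>2" "t \<noteq> 0"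
  shows "tangent_side E (pt s t) (pt s (- t))"
    "affine hull {pt s t, pt s (- t)} = dline (pt s t) w"
  using swap.tangent_side_u[OF assms] .

text \<open>Parallel sides make the vertices corners of a coordinate box, and tangency fixes the
  squares of their coordinates. The free signs of \<open>s\<close> and \<open>t\<close> account for
  the labelling of the vertices.\<close>

lemma circumscribed_diagonals_iff:
  "circumscribed_diagonals E (dline C u) (dline C w) d1 d2 \<longleftrightarrow>
    (\<exists>s t. s\<^sup>2 = a\<^sup>2 \<and> t\<^sup>2 = b\<^sup>2 \<and> d1 = dline C (s *\<^sub>R u + t *\<^sub>R w) \<and> d2 = dline C (s *\<^sub>R u - t *\<^sub>R w))"
proof
  assume "circumscribed_diagonals E (dline C u) (dline C w) d1 d2"
  then obtain p q r z where rect: "rectangle p q r z"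
    and tan: "tangent_side E p q" "tangent_side E q r" "tangent_side E r z" "tangent_side E z p"
    and par: "affine_parallel (affine hull {p, q}) (dline C u)"
      "affine_parallel (affine hull {q, r}) (dline C w)"
      "affine_parallel (affine hull {r, z}) (dline C u)"
      "affine_parallel (affine hull {z, p}) (dline C w)"
    and d: "d1 = affine hull {p, r}" "d2 = affine hull {q, z}"
    unfolding circumscribed_diagonals_def circumscribed_rectangle_def by blast
  have hulls: "affine hull {p, q} = dline p u" "affine hull {q, r} = dline q w"
    "affine hull {r, z} = dline r u" "affine hull {z, p} = dline z w"
    using par by (auto intro!: affine_parallel_dline hull_inc)
  obtain s t where p: "p = pt s t" by (rule pt_surj)
  have "q \<in> dline p u" using hulls(1) hull_inc[of q "{p, q}" affine] by auto
  then obtain s' where q: "q = pt s' t" by (auto simp: p dline_pt_u)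
  have "r \<in> dline q w" using hulls(2) hull_inc[of r "{q, r}" affine] by auto
  then obtain t' where r: "r = pt s' t'" by (auto simp: q swap.dline_pt_u)
  have "z = r - (q - p)" using rect by (simp add: rectangle_def)
  then have z: "z = pt s t'" by (simp add: p q r pt_def)
  have t: "t\<^sup>2 = b\<^sup>2" "t'\<^sup>2 = b\<^sup>2"
    using tangent_side_u_imp tan hulls unfolding p r by blast+
  have s: "s'\<^sup>2 = a\<^sup>2" "s\<^sup>2 = a\<^sup>2"
    using swap.tangent_side_u_imp tan hulls unfolding q z by blast+
  \<comment> \<open>Sides of nonzero length separate coordinates with equal squares, so these are
    opposite.\<close>
  have "s \<noteq> s'" "t \<noteq> t'" using rect by (auto simp: rectangle_def p q z)
  then have neg: "s' = - s" "t' = - t" using s t by (auto simp: power2_eq_iff)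
  have "d1 = dline C (s *\<^sub>R u + t *\<^sub>R w)"
    by (simp add: d p r neg affine_hull_pair_dline dline_diag)
  moreover have "d2 = dline C ((- s) *\<^sub>R u + t *\<^sub>R w)"
    using dline_diag[of "- s" t] by (simp add: d q z neg affine_hull_pair_dline)
  moreover have "dline C ((- s) *\<^sub>R u + t *\<^sub>R w) = dline C (s *\<^sub>R u - t *\<^sub>R w)"
    using dline_scale[of "- 1" C "s *\<^sub>R u - t *\<^sub>R w"] by simp
  ultimately show "\<exists>s t. s\<^sup>2 = a\<^sup>2 \<and> t\<^sup>2 = b\<^sup>2 \<and> d1 = dline C (s *\<^sub>R u + t *\<^sub>R w)
      \<and> d2 = dline C (s *\<^sub>R u - t *\<^sub>R w)" using s t by blast
next
  assume "\<exists>s t. s\<^sup>2 = a\<^sup>2 \<and> t\<^sup>2 = b\<^sup>2 \<and> d1 = dline C (s *\<^sub>R u + t *\<^sub>R w) \<and> d2 = dline C (s *\<^sub>R u - t *\<^sub>R w)"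
  then obtain s t where s: "s\<^sup>2 = a\<^sup>2" and t: "t\<^sup>2 = b\<^sup>2"
    and d: "d1 = dline C (s *\<^sub>R u + t *\<^sub>R w)" "d2 = dline C (s *\<^sub>R u - t *\<^sub>R w)" by blast
  have nz: "s \<noteq> 0" "t \<noteq> 0" using s t a b by auto
  let ?p = "pt s t" and ?q = "pt (- s) t" and ?r = "pt (- s) (- t)" and ?z = "pt s (- t)"
  have "rectangle ?p ?q ?r ?z"
  proof -
    have "?q - ?p = (- 2 * s) *\<^sub>R u" "?r - ?z = (- 2 * s) *\<^sub>R u" "?z - ?p = (- 2 * t) *\<^sub>R w"
      by (simp_all add: pt_def vec_eq_iff)
    then show ?thesis using nz by (simp add: rectangle_def orthogonal_def)
  qed
  moreover have "tangent_side E ?p ?q" "affine hull {?p, ?q} = dline ?p u"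
    using tangent_side_u[of t s] s t nz by auto
  moreover have "tangent_side E ?q ?r" "affine hull {?q, ?r} = dline ?q w"
    using tangent_side_w_rev[of "- s" t] s t nz by auto
  moreover have "tangent_side E ?r ?z" "affine hull {?r, ?z} = dline ?r u"
    using tangent_side_u[of "- t" "- s"] s t nz by auto
  moreover have "tangent_side E ?z ?p" "affine hull {?z, ?p} = dline ?z w"
    using tangent_side_w_rev[of s "- t"] s t nz by auto
  moreover have "d1 = affine hull {?p, ?r}"
    by (simp add: d affine_hull_pair_dline dline_diag)
  moreover have "d2 = affine hull {?q, ?z}"
  proof -
    have "affine hull {?q, ?z} = dline C ((- s) *\<^sub>R u + t *\<^sub>R w)"
      using dline_diag[of "- s" t] by (simp add: affine_hull_pair_dline)
    also have "\<dots> = dline C (s *\<^sub>R u - t *\<^sub>R w)"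
      using dline_scale[of "- 1" C "s *\<^sub>R u - t *\<^sub>R w"] by simp
    finally show ?thesis using d by simp
  qed
  ultimately show "circumscribed_diagonals E (dline C u) (dline C w) d1 d2"
    unfolding circumscribed_diagonals_def circumscribed_rectangle_def
    using affine_parallel_dline_dline by metis
qed

lemma diagonals_exist: "\<exists>d1 d2. circumscribed_diagonals E (dline C u) (dline C w) d1 d2"
  unfolding circumscribed_diagonals_iff by blast

text \<open>In the sum of the squared distances to the diagonals the mixed terms cancel, which
  leaves a multiple of the left side of the axis equation.\<close>

lemma diagonals_eccentrices:
  assumes "circumscribed_diagonals E (dline C u) (dline C w) d1 d2"
  shows "eccentrices E d1 d2 (2 * a\<^sup>2 * b\<^sup>2 / (a\<^sup>2 + b\<^sup>2))"
proof -
  obtain s t where s: "s\<^sup>2 = a\<^sup>2" and t: "t\<^sup>2 = b\<^sup>2"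
    and d: "d1 = dline C (s *\<^sub>R u + t *\<^sub>R w)" "d2 = dline C (s *\<^sub>R u - t *\<^sub>R w)"
    using assms unfolding circumscribed_diagonals_iff by blast
  have nz: "s \<noteq> 0" "t \<noteq> 0" using s t a b by auto
  define k where "k = sqrt (a\<^sup>2 + b\<^sup>2)"
  have k2: "k\<^sup>2 = a\<^sup>2 + b\<^sup>2" and k: "k > 0"
    using a b by (auto simp: k_def add_pos_pos)
  \<comment> \<open>Unit normals of the diagonals: the directions \<open>(s, t)\<close> and
    \<open>(s, - t)\<close> turned by a right angle, up to sign, and divided by the half-diagonal
    \<open>k\<close>.\<close>
  define n1 n2 where "n1 = (t / k) *\<^sub>R u - (s / k) *\<^sub>R w" and "n2 = (t / k) *\<^sub>R u + (s / k) *\<^sub>R w"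
  have unit: "(t / k)\<^sup>2 + (s / k)\<^sup>2 = 1"
    using s t k by (simp add: power_divide add.commute flip: k2 add_divide_distrib)
  then have n: "norm n1 = 1" "norm n2 = 1"
    by (auto simp: norm_eq_1 n1_def n2_def inner_simps power2_eq_square)
  have dnz: "s *\<^sub>R u + t *\<^sub>R w \<noteq> 0" "s *\<^sub>R u - t *\<^sub>R w \<noteq> 0"
  proof -
    have "u \<bullet> (s *\<^sub>R u + t *\<^sub>R w) \<noteq> 0" "u \<bullet> (s *\<^sub>R u - t *\<^sub>R w) \<noteq> 0"
      using nz by (simp_all add: inner_simps)
    then show "s *\<^sub>R u + t *\<^sub>R w \<noteq> 0" "s *\<^sub>R u - t *\<^sub>R w \<noteq> 0" by auto
  qed
  have d': "d1 = nline C n1" "d2 = nline C n2"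
    unfolding d using n dnz
    by (intro dline_eq_nline; auto simp: n1_def n2_def inner_simps)+
  have "C + 1 *\<^sub>R (s *\<^sub>R u + t *\<^sub>R w) \<in> d1" unfolding d dline_def by blast
  moreover have "C + 1 *\<^sub>R (s *\<^sub>R u + t *\<^sub>R w) \<notin> d2"
  proof -
    have "n2 \<bullet> (s *\<^sub>R u + t *\<^sub>R w) = 2 * s * t / k" by (simp add: n2_def inner_simps)
    then show ?thesis using nz k by (simp add: d' nline_def)
  qed
  ultimately have "d1 \<noteq> d2" by blast
  moreover have "2 * a\<^sup>2 * b\<^sup>2 / (a\<^sup>2 + b\<^sup>2) > 0" using a b by (simp add: add_pos_pos)
  moreover have "P \<in> E \<longleftrightarrow> (n1 \<bullet> (P - C))\<^sup>2 + (n2 \<bullet> (P - C))\<^sup>2 = 2 * a\<^sup>2 * b\<^sup>2 / (a\<^sup>2 + b\<^sup>2)" for P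
  proof -
    obtain x y where P: "P = pt x y" by (rule pt_surj)
    have n_P: "n1 \<bullet> (P - C) = (t * x - s * y) / k" "n2 \<bullet> (P - C) = (t * x + s * y) / k"
      by (auto simp: P pt_def n1_def n2_def inner_simps diff_divide_distrib add_divide_distrib mult.commute)
    have "(n1 \<bullet> (P - C))\<^sup>2 + (n2 \<bullet> (P - C))\<^sup>2 = ((t * x - s * y)\<^sup>2 + (t * x + s * y)\<^sup>2) / (a\<^sup>2 + b\<^sup>2)"
      by (simp only: n_P power_divide k2 flip: add_divide_distrib)
    also have "(t * x - s * y)\<^sup>2 + (t * x + s * y)\<^sup>2 = 2 * (t\<^sup>2 * x\<^sup>2 + s\<^sup>2 * y\<^sup>2)"
      by (simp add: power2_eq_square algebra_simps)
    also have "\<dots> = 2 * (b\<^sup>2 * x\<^sup>2 + a\<^sup>2 * y\<^sup>2)" by (simp add: s t)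
    finally show ?thesis
      using a b k k2 by (simp add: P pt_in_E) auto
  qed
  ultimately show ?thesis
    unfolding d' using n by (subst eccentrices_nline_iff) auto
qed

text \<open>Certifies the frame of bisectors as axes when the ellipse is a circle.\<close>

lemma frame_ellipse_axes:
  assumes "b \<le> a"
  shows "ellipse_axes E C a b (dline C u) (dline C w)"
proof -
  have "is_line (dline C u)" "is_line (dline C w)"
    using nu nw by (auto intro!: is_line_dline)
  moreover have "perpendicular_sets (dline C u) (dline C w)"
    by (auto simp: perpendicular_sets_def dline_def orthogonal_def inner_simps)
  moreover have "pt a 0 \<in> E \<inter> dline C u" "dist C (pt a 0) = a"
    "pt 0 b \<in> E \<inter> dline C w" "dist C (pt 0 b) = b"
    using a b nu nw by (auto simp: pt_in_E, auto simp: pt_def dline_def dist_norm)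
  ultimately show ?thesis
    unfolding ellipse_axes_def using symmetric_about_u swap.symmetric_about_u assms
    by (auto intro!: bexI)
qed

end

text \<open>In a frame of axes the normals \<open>(x1, y1)\<close>, \<open>(x2, y2)\<close> of the eccentrices satisfy
  \<open>x1 y1 + x2 y2 = 0\<close>, whence \<open>(x1\<^sup>2 - x2\<^sup>2) (1 - x1\<^sup>2 - x2\<^sup>2) = 0\<close>; the second factor vanishes
  only for circles.\<close>

lemma unit_pairs_diagonal_form:
  fixes x1 y1 x2 y2 :: real
  assumes "x1\<^sup>2 + y1\<^sup>2 = 1" "x2\<^sup>2 + y2\<^sup>2 = 1" "x1 * y1 + x2 * y2 = 0" "x1\<^sup>2 + x2\<^sup>2 \<noteq> 1"
  shows "x1\<^sup>2 = x2\<^sup>2" "y1\<^sup>2 = y2\<^sup>2" "x1 * y2 + x2 * y1 = 0"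
proof -
  have "(x1\<^sup>2 - x2\<^sup>2) * (1 - x1\<^sup>2 - x2\<^sup>2) = 0" using assms(1-3) by algebra
  then show x: "x1\<^sup>2 = x2\<^sup>2" using assms(4) by auto
  then show "y1\<^sup>2 = y2\<^sup>2" using assms by simp
  have "(x1\<^sup>2 + x2\<^sup>2 - 1) * (x1 * y2 + x2 * y1) = 0" using assms(1-3) by algebra
  then show "x1 * y2 + x2 * y1 = 0" using assms(4) by simp
qed

section \<open>Eccentrices related to the frame of the axes\<close>

locale ellipse_eccentrices =
  fixes E :: "plane set" and C u w n1 n2 :: plane and a b c :: real
  assumes n: "norm n1 = 1" "norm n2 = 1" "nline C n1 \<noteq> nline C n2" and c: "c > 0"
    and E_ecc: "E = {P. (n1 \<bullet> (P - C))\<^sup>2 + (n2 \<bullet> (P - C))\<^sup>2 = c}"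
    and fr: "norm u = 1" "norm w = 1" "u \<bullet> w = 0"
    and ax: "ellipse_axes E C a b (dline C u) (dline C w)"
begin

lemma unit: "(n1 \<bullet> u)\<^sup>2 + (n1 \<bullet> w)\<^sup>2 = 1" "(n2 \<bullet> u)\<^sup>2 + (n2 \<bullet> w)\<^sup>2 = 1"
proof -
  have "(v \<bullet> u)\<^sup>2 + (v \<bullet> w)\<^sup>2 = v \<bullet> v" for v :: plane
  proof -
    have "v \<bullet> v = v \<bullet> ((u \<bullet> v) *\<^sub>R u + (w \<bullet> v) *\<^sub>R w)"
      using orthonormal_plane_expand[OF fr, of v] by simp
    then show ?thesis by (simp add: inner_simps inner_commute power2_eq_square)
  qed
  then show "(n1 \<bullet> u)\<^sup>2 + (n1 \<bullet> w)\<^sup>2 = 1" "(n2 \<bullet> u)\<^sup>2 + (n2 \<bullet> w)\<^sup>2 = 1"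
    using n by (simp_all add: norm_eq_1)
qed

lemma mixed: "(n1 \<bullet> u) * (n1 \<bullet> w) + (n2 \<bullet> u) * (n2 \<bullet> w) = 0"
  using axes_diagonalize[OF n c E_ecc fr] ax by (simp add: ellipse_axes_def)

text \<open>A point of the axis is \<open>C + t *\<^sub>R v\<close> with
  \<open>\<bar>t\<bar> = r\<close>, and the form scales by \<open>t\<^sup>2\<close>. Positivity of
  \<open>c\<close> excludes \<open>r = 0\<close>.\<close>

lemma axis_coeff:
  assumes "P \<in> E \<inter> dline C v" "dist C P = r" "norm v = 1"
  shows "((n1 \<bullet> v)\<^sup>2 + (n2 \<bullet> v)\<^sup>2) * r\<^sup>2 = c" "r > 0"
proof -
  obtain t where P: "P = C + t *\<^sub>R v" using assms by (auto simp: dline_def)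
  have "\<bar>t\<bar> = r" using assms by (auto simp: P dist_norm)
  then have "r\<^sup>2 = t\<^sup>2" "r \<ge> 0" by auto
  moreover have "((n1 \<bullet> v)\<^sup>2 + (n2 \<bullet> v)\<^sup>2) * t\<^sup>2 = c"
    using assms(1) by (simp add: E_ecc P power_mult_distrib algebra_simps)
  ultimately show "((n1 \<bullet> v)\<^sup>2 + (n2 \<bullet> v)\<^sup>2) * r\<^sup>2 = c" "r > 0"
    using c by (auto simp: order_le_less)
qed

lemma coeffs: "((n1 \<bullet> u)\<^sup>2 + (n2 \<bullet> u)\<^sup>2) * a\<^sup>2 = c" "((n1 \<bullet> w)\<^sup>2 + (n2 \<bullet> w)\<^sup>2) * b\<^sup>2 = c"
  and ab: "a > 0" "b > 0" "b \<le> a"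
proof -
  obtain P Q where "P \<in> E \<inter> dline C u" "dist C P = a" "Q \<in> E \<inter> dline C w" "dist C Q = b" "b \<le> a"
    using ax by (auto simp: ellipse_axes_def)
  with axis_coeff fr show "((n1 \<bullet> u)\<^sup>2 + (n2 \<bullet> u)\<^sup>2) * a\<^sup>2 = c"
    "((n1 \<bullet> w)\<^sup>2 + (n2 \<bullet> w)\<^sup>2) * b\<^sup>2 = c" "a > 0" "b > 0" "b \<le> a" by metis+
qed

lemma constant_mult: "c * (a\<^sup>2 + b\<^sup>2) = 2 * a\<^sup>2 * b\<^sup>2"
proof -
  define A D where "A = (n1 \<bullet> u)\<^sup>2 + (n2 \<bullet> u)\<^sup>2" and "D = (n1 \<bullet> w)\<^sup>2 + (n2 \<bullet> w)\<^sup>2"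
  have "A * a\<^sup>2 = c" "D * b\<^sup>2 = c" using coeffs by (simp_all add: A_def D_def)
  \<comment> \<open>Crosswise substitution: \<open>c\<close> is written as
    \<open>D * b\<^sup>2\<close> next to \<open>a\<^sup>2\<close> and as
    \<open>A * a\<^sup>2\<close> next to \<open>b\<^sup>2\<close>, so that the trace
    \<open>A + D\<close> factors out.\<close>
  then have "c * (a\<^sup>2 + b\<^sup>2) = (D * b\<^sup>2) * a\<^sup>2 + (A * a\<^sup>2) * b\<^sup>2" by (simp only: distrib_left)
  then have "c * (a\<^sup>2 + b\<^sup>2) = (A + D) * (a\<^sup>2 * b\<^sup>2)" by (simp only: algebra_simps)
  moreover have "A + D = 2" using unit by (simp add: A_def D_def)
  ultimately show ?thesis by simp
qed

lemma constant_eq: "c = 2 * a\<^sup>2 * b\<^sup>2 / (a\<^sup>2 + b\<^sup>2)"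
  using constant_mult ab by (simp add: field_simps sum_power2_eq_zero_iff)

text \<open>With the mixed coefficient zero, the form has only the coefficients
  \<open>c / a\<^sup>2\<close> and \<open>c / b\<^sup>2\<close>; cancelling \<open>c\<close> gives
  the axis equation.\<close>

sublocale ellipse_frame E C u w a b
proof (unfold_locales)
  show "norm u = 1" "norm w = 1" "u \<bullet> w = 0" "a > 0" "b > 0" using fr ab by auto
  have "P \<in> E \<longleftrightarrow> b\<^sup>2 * (u \<bullet> (P - C))\<^sup>2 + a\<^sup>2 * (w \<bullet> (P - C))\<^sup>2 = a\<^sup>2 * b\<^sup>2" for P
  proof -
    define s t where "s = u \<bullet> (P - C)" and "t = w \<bullet> (P - C)"
    have PC: "P - C = s *\<^sub>R u + t *\<^sub>R w"
      using orthonormal_plane_expand[OF fr] by (simp add: s_def t_def)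
    have "P \<in> E \<longleftrightarrow> (n1 \<bullet> (s *\<^sub>R u + t *\<^sub>R w))\<^sup>2 + (n2 \<bullet> (s *\<^sub>R u + t *\<^sub>R w))\<^sup>2 = c"
      by (simp add: E_ecc PC)
    also have "(n1 \<bullet> (s *\<^sub>R u + t *\<^sub>R w))\<^sup>2 + (n2 \<bullet> (s *\<^sub>R u + t *\<^sub>R w))\<^sup>2
        = ((n1 \<bullet> u)\<^sup>2 + (n2 \<bullet> u)\<^sup>2) * s\<^sup>2 + ((n1 \<bullet> w)\<^sup>2 + (n2 \<bullet> w)\<^sup>2) * t\<^sup>2"
      unfolding inner_add_right inner_scaleR_right using mixed by algebra
    also have "(n1 \<bullet> u)\<^sup>2 + (n2 \<bullet> u)\<^sup>2 = c / a\<^sup>2" using coeffs(1) ab by (simp add: field_simps)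
    also have "(n1 \<bullet> w)\<^sup>2 + (n2 \<bullet> w)\<^sup>2 = c / b\<^sup>2" using coeffs(2) ab by (simp add: field_simps)
    also have "c / a\<^sup>2 * s\<^sup>2 + c / b\<^sup>2 * t\<^sup>2 = c * ((b\<^sup>2 * s\<^sup>2 + a\<^sup>2 * t\<^sup>2) / (a\<^sup>2 * b\<^sup>2))"
      using ab by (simp add: field_simps)
    also have "\<dots> = c \<longleftrightarrow> b\<^sup>2 * s\<^sup>2 + a\<^sup>2 * t\<^sup>2 = a\<^sup>2 * b\<^sup>2"
      using c ab by (simp only: mult_cancel_left2) (auto simp: divide_eq_1_iff)
    finally show ?thesis by (simp add: s_def t_def)
  qed
  then show "E = {P. b\<^sup>2 * (u \<bullet> (P - C))\<^sup>2 + a\<^sup>2 * (w \<bullet> (P - C))\<^sup>2 = a\<^sup>2 * b\<^sup>2}" by blast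
qed

lemma eccentrices_are_diagonals:
  assumes "a \<noteq> b"
  shows "circumscribed_diagonals E (dline C u) (dline C w) (nline C n1) (nline C n2)"
proof -
  define x1 y1 x2 y2 where xy: "x1 = n1 \<bullet> u" "y1 = n1 \<bullet> w" "x2 = n2 \<bullet> u" "y2 = n2 \<bullet> w"
  define k where "k = sqrt (a\<^sup>2 + b\<^sup>2)"
  have k2: "k\<^sup>2 = a\<^sup>2 + b\<^sup>2" and k: "k > 0" using ab by (auto simp: k_def add_pos_pos)
  have un: "x1\<^sup>2 + y1\<^sup>2 = 1" "x2\<^sup>2 + y2\<^sup>2 = 1" using unit by (auto simp: xy)
  have mx: "x1 * y1 + x2 * y2 = 0" using mixed by (simp add: xy)
  have cf: "(x1\<^sup>2 + x2\<^sup>2) * a\<^sup>2 = c" "(y1\<^sup>2 + y2\<^sup>2) * b\<^sup>2 = c" using coeffs by (auto simp: xy)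
  \<comment> \<open>If one diagonal coefficient were \<open>1\<close>, so would be the other by the
    trace, and the semi-axes would be equal.\<close>
  have "x1\<^sup>2 + x2\<^sup>2 \<noteq> 1"
  proof
    assume one: "x1\<^sup>2 + x2\<^sup>2 = 1"
    then have "y1\<^sup>2 + y2\<^sup>2 = 1" using un by simp
    then have "a\<^sup>2 = b\<^sup>2" using cf one by simp
    then show False using assms ab by simp
  qed
  note eqs = unit_pairs_diagonal_form[OF un mx this]
  \<comment> \<open>The normal \<open>(x1, y1)\<close> turned by a right angle is a direction of the
    first eccentrix; the factor \<open>k\<close> stretches it to half a diagonal, so that it ends in
    a vertex.\<close>
  define s t where "s = - k * y1" and "t = k * x1"
  have "(x1\<^sup>2 + x1\<^sup>2) * a\<^sup>2 = (y1\<^sup>2 + y1\<^sup>2) * b\<^sup>2" using cf by (simp only: eqs(1,2))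
  then have "a\<^sup>2 * x1\<^sup>2 = b\<^sup>2 * y1\<^sup>2" by (simp add: algebra_simps)
  then have "k\<^sup>2 * x1\<^sup>2 = b\<^sup>2 * (x1\<^sup>2 + y1\<^sup>2)" "k\<^sup>2 * y1\<^sup>2 = a\<^sup>2 * (x1\<^sup>2 + y1\<^sup>2)"
    by (simp_all add: k2 algebra_simps)
  then have "k\<^sup>2 * x1\<^sup>2 = b\<^sup>2" "k\<^sup>2 * y1\<^sup>2 = a\<^sup>2" by (simp_all add: un(1))
  then have st: "s\<^sup>2 = a\<^sup>2" "t\<^sup>2 = b\<^sup>2" by (auto simp: s_def t_def power_mult_distrib)
  then have nz: "s \<noteq> 0" using ab by auto
  have "u \<bullet> (s *\<^sub>R u + t *\<^sub>R w) = s" "u \<bullet> (s *\<^sub>R u - t *\<^sub>R w) = s" by (auto simp: inner_simps)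
  then have dnz: "s *\<^sub>R u + t *\<^sub>R w \<noteq> 0" "s *\<^sub>R u - t *\<^sub>R w \<noteq> 0" using nz by auto
  have "n1 \<bullet> (s *\<^sub>R u + t *\<^sub>R w) = 0"
    by (simp add: inner_simps s_def t_def flip: xy)
  then have 1: "nline C n1 = dline C (s *\<^sub>R u + t *\<^sub>R w)"
    using dnz n by (intro dline_eq_nline[symmetric]) auto
  \<comment> \<open>The other diagonal has the direction \<open>(s, - t)\<close>; it is
    perpendicular to \<open>n2\<close> by the last relation of \<open>eqs\<close>.\<close>
  have "n2 \<bullet> (s *\<^sub>R u - t *\<^sub>R w) = - k * (x1 * y2 + x2 * y1)"
    by (simp add: inner_simps s_def t_def algebra_simps flip: xy)
  then have "n2 \<bullet> (s *\<^sub>R u - t *\<^sub>R w) = 0" using eqs(3) by simp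
  then have 2: "nline C n2 = dline C (s *\<^sub>R u - t *\<^sub>R w)"
    using dnz n by (intro dline_eq_nline[symmetric]) auto
  show ?thesis unfolding circumscribed_diagonals_iff 1 2 using st by blast
qed

text \<open>For a circle the eccentrices are perpendicular, and their bisectors serve as the axes.\<close>

lemma circle_axes:
  assumes "a = b"
  shows "\<exists>m1 m2. ellipse_axes E C a b m1 m2 \<and>
    circumscribed_diagonals E m1 m2 (nline C n1) (nline C n2)"
proof -
  have caa: "c = a\<^sup>2" using constant_mult assms ab by (simp add: power2_eq_square)
  have nn: "n1 \<bullet> n1 = 1" "n2 \<bullet> n2 = 1" using n by (auto simp: norm_eq_1)
  have orth: "n1 \<bullet> n2 = 0"
  proof -
    have one: "(n1 \<bullet> u)\<^sup>2 + (n2 \<bullet> u)\<^sup>2 = 1" "(n1 \<bullet> w)\<^sup>2 + (n2 \<bullet> w)\<^sup>2 = 1"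
      using coeffs caa assms ab by simp_all
    have "n1 \<bullet> n2 = n1 \<bullet> ((u \<bullet> n2) *\<^sub>R u + (w \<bullet> n2) *\<^sub>R w)"
      using orthonormal_plane_expand[OF fr, of n2] by simp
    also have "\<dots> = (n1 \<bullet> u) * (n2 \<bullet> u) + (n1 \<bullet> w) * (n2 \<bullet> w)"
      by (simp add: inner_simps inner_commute mult.commute)
    \<comment> \<open>By \<open>one\<close> and \<open>mixed\<close> the coordinate matrix of the
      normals has orthonormal columns, hence orthogonal rows.\<close>
    also have "\<dots> = 0" using one mixed by algebra
    finally show ?thesis .
  qed
  then have orth': "n2 \<bullet> n1 = 0" by (simp add: inner_commute)
  define e1 e2 where "e1 = (1 / sqrt 2) *\<^sub>R (n1 + n2)" and "e2 = (1 / sqrt 2) *\<^sub>R (n2 - n1)"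
  interpret B: ellipse_frame E C e1 e2 a b
  proof unfold_locales
    show "norm e1 = 1" "norm e2 = 1" "e1 \<bullet> e2 = 0"
      by (auto simp: norm_eq_1 e1_def e2_def inner_simps nn orth orth' field_simps)
    show "a > 0" "b > 0" using ab by auto
    have "(e1 \<bullet> x)\<^sup>2 + (e2 \<bullet> x)\<^sup>2 = (n1 \<bullet> x)\<^sup>2 + (n2 \<bullet> x)\<^sup>2" for x
      by (simp add: e1_def e2_def inner_simps power_divide power2_eq_square field_simps)
    then have "b\<^sup>2 * (e1 \<bullet> x)\<^sup>2 + a\<^sup>2 * (e2 \<bullet> x)\<^sup>2 = a\<^sup>2 * b\<^sup>2 \<longleftrightarrow> (n1 \<bullet> x)\<^sup>2 + (n2 \<bullet> x)\<^sup>2 = c" for x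
      unfolding caa assms distrib_left[symmetric] mult_cancel_left using ab by simp
    then show "E = {P. b\<^sup>2 * (e1 \<bullet> (P - C))\<^sup>2 + a\<^sup>2 * (e2 \<bullet> (P - C))\<^sup>2 = a\<^sup>2 * b\<^sup>2}"
      by (simp add: E_ecc)
  qed
  \<comment> \<open>The diagonals of the circumscribed square have directions \<open>n2\<close> and
    \<open>n1\<close>; as the normals are perpendicular, these are the lines with normals
    \<open>n1\<close> and \<open>n2\<close>, in this order.\<close>
  have "a *\<^sub>R e1 + b *\<^sub>R e2 = (2 * a / sqrt 2) *\<^sub>R n2" "a *\<^sub>R e1 - b *\<^sub>R e2 = (2 * a / sqrt 2) *\<^sub>R n1"
    by (auto simp: e1_def e2_def assms vec_eq_iff field_simps)
  then have "dline C (a *\<^sub>R e1 + b *\<^sub>R e2) = dline C n2" "dline C (a *\<^sub>R e1 - b *\<^sub>R e2) = dline C n1"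
    using ab by (simp_all add: dline_scale)
  moreover have "dline C n2 = nline C n1" "dline C n1 = nline C n2"
    using n orth orth' by (intro dline_eq_nline; auto)+
  ultimately have "circumscribed_diagonals E (dline C e1) (dline C e2) (nline C n1) (nline C n2)"
    unfolding B.circumscribed_diagonals_iff by metis
  then show ?thesis using B.frame_ellipse_axes ab by blast
qed

text \<open>A direction vector of the line is scaled onto \<open>E\<close>.\<close>

lemma nline_meets_E:
  assumes "norm v = 1"
  shows "nline C v \<inter> E \<noteq> {}"
proof -
  obtain d where d: "norm d = 1" "v \<bullet> d = 0" using plane_unit_perp[OF assms] .
  then have "d \<noteq> 0" by auto
  from form_scale_to[OF nline_distinct_form_pos[OF n this] c] obtain k where
    "(n1 \<bullet> (k *\<^sub>R d))\<^sup>2 + (n2 \<bullet> (k *\<^sub>R d))\<^sup>2 = c" by metis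
  then have "C + k *\<^sub>R d \<in> nline C v \<inter> E" using d by (simp add: E_ecc nline_def)
  then show ?thesis by blast
qed

text \<open>With weights \<open>1\<close> the metric is the square root of the quadratic form, and
  the stated radius is \<open>sqrt c\<close>.\<close>

lemma vE_circle: "is_vE_circle 1 1 n1 n2 C (sqrt 2 * a * b / sqrt (a\<^sup>2 + b\<^sup>2)) E"
proof -
  have distinct: "n1 \<noteq> n2" using n by auto
  \<comment> \<open>Parallel normals would give equal eccentrices.\<close>
  have "n1 \<noteq> k *\<^sub>R n2" for k
  proof
    assume "n1 = k *\<^sub>R n2"
    moreover from this have "k \<noteq> 0" using n by auto
    ultimately have "nline C n1 = nline C n2" by (auto simp: nline_def)
    then show False using n by blast
  qed
  moreover have "n2 \<noteq> 0" using n by auto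
  ultimately have indep: "independent {n1, n2}"
    using distinct by (auto simp: independent_insert span_singleton)
  have r: "sqrt 2 * a * b / sqrt (a\<^sup>2 + b\<^sup>2) = sqrt c"
    using ab by (simp add: constant_eq real_sqrt_divide real_sqrt_mult)
  have v: "v $ 1 * (C $ 1 - P $ 1) + v $ 2 * (C $ 2 - P $ 2) = - (v \<bullet> (P - C))" for v P :: plane
    by (simp add: inner_vec_def sum_2 algebra_simps)
  have "dist_vE 1 1 n1 n2 C P = sqrt ((n1 \<bullet> (P - C))\<^sup>2 + (n2 \<bullet> (P - C))\<^sup>2)" for P
    unfolding dist_vE_def v by simp
  then have "E = {P. dist_vE 1 1 n1 n2 C P = sqrt c}" by (simp add: E_ecc)
  then show ?thesis unfolding is_vE_circle_def r using n distinct indep c by simp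
qed

end

section \<open>From the given axes and eccentrices to frames and normals\<close>

lemma ellipse_axes_frame:
  assumes "ellipse_axes E C a b m1 m2"
  obtains u w where "norm u = 1" "norm w = 1" "u \<bullet> w = 0" "m1 = dline C u" "m2 = dline C w"
proof -
  have m: "is_line m1" "is_line m2" "C \<in> m1" "C \<in> m2" "perpendicular_sets m1 m2"
    using assms by (auto simp: ellipse_axes_def)
  obtain u where u: "norm u = 1" "m1 = dline C u" using is_line_obtain_dline m(1,3) .
  obtain w where w: "norm w = 1" "m2 = dline C w" using is_line_obtain_dline m(2,4) .
  have "u \<bullet> w = 0" using m(5) u w perpendicular_dline_inner by blast
  then show ?thesis using that u w by blast
qed

theorem corollary5p2:
  fixes E :: "(real ^ 2) set" and C :: "real ^ 2" and a b :: real
    and m1 m2 :: "(real ^ 2) set"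
  assumes "is_ellipse E" and "is_center E C" and "ellipse_axes E C a b m1 m2"
  shows "(\<exists>d1 d2. circumscribed_diagonals E m1 m2 d1 d2) \<and>
    (\<forall>d1 d2. circumscribed_diagonals E m1 m2 d1 d2 \<longrightarrow>
       eccentrices E d1 d2 (2 * a\<^sup>2 * b\<^sup>2 / (a\<^sup>2 + b\<^sup>2))) \<and>
    (\<forall>l1 l2 c. eccentrices E l1 l2 c \<longrightarrow>
       (a \<noteq> b \<longrightarrow> circumscribed_diagonals E m1 m2 l1 l2) \<and>
       (\<exists>n1 n2. ellipse_axes E C a b n1 n2 \<and> circumscribed_diagonals E n1 n2 l1 l2) \<and>
       c = 2 * a\<^sup>2 * b\<^sup>2 / (a\<^sup>2 + b\<^sup>2) \<and>
       l1 \<inter> E \<noteq> {} \<and> (\<forall>Q\<in>l1 \<inter> E. c = (infdist Q l2)\<^sup>2) \<and>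
       l2 \<inter> E \<noteq> {} \<and> (\<forall>Q\<in>l2 \<inter> E. c = (infdist Q l1)\<^sup>2) \<and>
       (\<exists>v1 v2. norm v1 = 1 \<and> norm v2 = 1 \<and> normal_to v1 l1 \<and> normal_to v2 l2) \<and>
       (\<forall>v1 v2. norm v1 = 1 \<and> norm v2 = 1 \<and> normal_to v1 l1 \<and> normal_to v2 l2 \<longrightarrow>
          is_vE_circle 1 1 v1 v2 C (sqrt 2 * a * b / sqrt (a\<^sup>2 + b\<^sup>2)) E))"
proof -
  obtain u w where fr: "norm u = 1" "norm w = 1" "u \<bullet> w = 0"
    and m: "m1 = dline C u" "m2 = dline C w" using ellipse_axes_frame[OF assms(3)] .
  have loc: "ellipse_eccentrices E C u w n1 n2 a b c" "l1 = nline C n1" "l2 = nline C n2"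
    if "eccentrices E l1 l2 c" "norm n1 = 1" "normal_to n1 l1" "norm n2 = 1" "normal_to n2 l2"
    for l1 l2 c n1 n2
    using eccentrices_at_center[OF that(1) assms(2) that(2-5)] that fr assms(3)
    by (auto simp: ellipse_eccentrices_def m)
  have normals: "\<exists>v1 v2. norm v1 = 1 \<and> norm v2 = 1 \<and> normal_to v1 l1 \<and> normal_to v2 l2"
    if "eccentrices E l1 l2 c" for l1 l2 c
  proof -
    have "is_line l1" "is_line l2" using that by (auto simp: eccentrices_def)
    then show ?thesis using is_line_obtain_normal by metis
  qed
  \<comment> \<open>One pair of eccentrices suffices for the two claims on circumscribed diagonals,
    which depend only on \<open>E\<close>, the axes, \<open>a\<close> and \<open>b\<close>.\<close>
  obtain l1 l2 c where ecc: "eccentrices E l1 l2 c" using assms(1) by (auto simp: is_ellipse_def)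
  obtain n1 n2 where "norm n1 = 1" "norm n2 = 1" "normal_to n1 l1" "normal_to n2 l2"
    using normals[OF ecc] by blast
  then interpret F: ellipse_eccentrices E C u w n1 n2 a b c using loc(1) ecc by blast
  have ecc_facts: "(a \<noteq> b \<longrightarrow> circumscribed_diagonals E m1 m2 k1 k2) \<and>
       (\<exists>n1 n2. ellipse_axes E C a b n1 n2 \<and> circumscribed_diagonals E n1 n2 k1 k2) \<and>
       e = 2 * a\<^sup>2 * b\<^sup>2 / (a\<^sup>2 + b\<^sup>2) \<and>
       k1 \<inter> E \<noteq> {} \<and> (\<forall>Q\<in>k1 \<inter> E. e = (infdist Q k2)\<^sup>2) \<and>
       k2 \<inter> E \<noteq> {} \<and> (\<forall>Q\<in>k2 \<inter> E. e = (infdist Q k1)\<^sup>2)"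
    if k: "eccentrices E k1 k2 e" for k1 k2 e
  proof -
    obtain v1 v2 where v: "norm v1 = 1" "norm v2 = 1" "normal_to v1 k1" "normal_to v2 k2"
      using normals[OF k] by blast
    note l = loc[OF k v(1,3,2,4)]
    interpret G: ellipse_eccentrices E C u w v1 v2 a b e using l(1) .
    have dist: "P \<in> E \<Longrightarrow> (infdist P k1)\<^sup>2 + (infdist P k2)\<^sup>2 = e" for P
      using k by (auto simp: eccentrices_def)
    \<comment> \<open>On one eccentrix its own distance vanishes, so the other squared distance is
      the whole constant.\<close>
    have e: "\<forall>Q\<in>k1 \<inter> E. e = (infdist Q k2)\<^sup>2" "\<forall>Q\<in>k2 \<inter> E. e = (infdist Q k1)\<^sup>2"
      using dist by fastforce+
    have "a \<noteq> b \<longrightarrow> circumscribed_diagonals E m1 m2 k1 k2"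
      using G.eccentrices_are_diagonals by (simp add: m l)
    \<comment> \<open>The given axes serve if \<open>a \<noteq> b\<close>, the bisectors of the
      eccentrices if \<open>a = b\<close>.\<close>
    moreover have "\<exists>n1 n2. ellipse_axes E C a b n1 n2 \<and> circumscribed_diagonals E n1 n2 k1 k2"
      using G.circle_axes calculation assms(3) unfolding l(2,3) by blast
    moreover have "k1 \<inter> E \<noteq> {}" "k2 \<inter> E \<noteq> {}" using G.nline_meets_E v l by auto
    ultimately show ?thesis using e G.constant_eq by blast
  qed
  have circle: "\<forall>v1 v2. norm v1 = 1 \<and> norm v2 = 1 \<and> normal_to v1 k1 \<and> normal_to v2 k2 \<longrightarrow>
      is_vE_circle 1 1 v1 v2 C (sqrt 2 * a * b / sqrt (a\<^sup>2 + b\<^sup>2)) E"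
    if "eccentrices E k1 k2 e" for k1 k2 e
    using ellipse_eccentrices.vE_circle loc(1) that by blast
  show ?thesis
  proof (rule conjI[OF _ conjI], goal_cases)
    case 1
    show ?case using F.diagonals_exist by (simp add: m)
  next
    case 2
    show ?case using F.diagonals_eccentrices by (simp add: m)
  next
    case 3
    show ?case
    proof (intro allI impI, goal_cases)
      case (1 l1 l2 c)
      show ?case
        using ecc_facts[OF 1] normals[OF 1] circle[OF 1] by (elim conjE, intro conjI)
    qed
  qed
qed

end
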